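(* Let $E$ be a $2$-concave symmetric Banach sequence space. Then there are constants $c,C>0$ such that for all integers $1\le k\le n$ $$c\,\frac{\lambda_E(n-k+1)}{(n-k+1)^{1/2}}\ \le\ a_k(\mathrm{id}:\ell_2^n\hookrightarrow E_n)\ \le\ C\,\frac{\lambda_E(n-k+1)}{(n-k+1)^{1/2}}.$$
   Context: A Banach sequence space is a real Banach space $E$ of real sequences (indexed by $\mathbb{N}$) which contains some $x$ with $x_n\neq 0$ for all $n$ and such that $y\in E$, $|x_n|\le |y_n|$ for all $n$ imply $x\in E$ and $\|x\|_E\le\|y\|_E$. $E$ is symmetric if $\|(x_n)\|_E=\|(x_n^* )\|_E$, where $(x_n^* )$ is the decreasing rearrangement of $(x_n)$: $x_n^*=\inf\{\sup_{i\in\mathbb{N}\setminus J}|x_i| : J\subset\mathbb{N},\ \mathrm{card}(J)<n\}$. $E$ is $2$-concave if there is $C>0$ such that $(\sum_{i=1}^n\|x_i\|_E^2)^{1/2}\le C\,\|(\sum_{i=1}^n|x_i|^2)^{1/2}\|_E$ for all finite families $x_1,\dots,x_n\in E$. $(e_i)$ are the standard unit vectors; $E_n$ is the linear span of $e_1,\dots,e_n$ in $E$ with the norm of $E$, and $\ell_2^n=(\ell_2)_n$. The fundamental function of $E$ is $\lambda_E(n)=\|\sum_{i=1}^n e_i\|_E$. For an operator $T:X\to Y$ between Banach spaces the $k$-th approximation number is $a_k(T)=\inf\{\|T-T_k\| : T_k:X\to Y \text{ bounded linear of rank}<k\}$. *)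

theory Defs
  imports "HOL-Analysis.Analysis" "HOL-Library.Function_Algebras"
begin

instantiation "fun" :: (type, real_vector) real_vector
begin

definition "scaleR c f = (\<lambda>x. c *\<^sub>R f x)"

instance
  by standard (auto simp: scaleR_fun_def fun_eq_iff algebra_simps)

end

section \<open>Banach sequence spaces\<close>

text \<open>A sequence space is a carrier \<open>E\<close> together with a function \<open>N\<close> of which only the values on
  \<open>E\<close> matter. Sequences are indexed from 0, so \<open>x n\<close> is the entry usually written
  \<open>x\<close> with index \<open>n + 1\<close>.\<close>

locale banach_sequence_space =
  fixes E :: "(nat \<Rightarrow> real) set" and N :: "(nat \<Rightarrow> real) \<Rightarrow> real"
  assumes subspace_E: "subspace E"
    and norm_ge_0: "x \<in> E \<Longrightarrow> 0 \<le> N x"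
    and norm_eq_0: "x \<in> E \<Longrightarrow> N x = 0 \<longleftrightarrow> x = 0"
    and norm_triangle: "x \<in> E \<Longrightarrow> y \<in> E \<Longrightarrow> N (x + y) \<le> N x + N y"
    and norm_scaleR: "x \<in> E \<Longrightarrow> N (c *\<^sub>R x) = \<bar>c\<bar> * N x"
    and complete: "\<lbrakk>\<And>j. f j \<in> E; \<And>e. e > 0 \<Longrightarrow> \<exists>M. \<forall>i\<ge>M. \<forall>j\<ge>M. N (f i - f j) < e\<rbrakk>
                    \<Longrightarrow> \<exists>x\<in>E. (\<lambda>j. N (f j - x)) \<longlonglongrightarrow> 0"
    and full_support: "\<exists>x\<in>E. \<forall>n. x n \<noteq> 0"
    and ideal: "y \<in> E \<Longrightarrow> (\<And>n. \<bar>x n\<bar> \<le> \<bar>y n\<bar>) \<Longrightarrow> x \<in> E \<and> N x \<le> N y"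

text \<open>The value is an extended real because it is infinite for unbounded \<open>x\<close>. With entries indexed
  from 0, the bound on the cardinality is \<open>card J \<le> n\<close>.\<close>

definition decreasing_rearrangement :: "(nat \<Rightarrow> real) \<Rightarrow> nat \<Rightarrow> ereal" where
  "decreasing_rearrangement x n =
     (INF J\<in>{J. finite J \<and> card J \<le> n}. SUP i\<in>UNIV - J. ereal \<bar>x i\<bar>)"

text \<open>The norm equation includes that the rearrangement is a (finite) sequence belonging to \<open>E\<close>.\<close>

locale symmetric_banach_sequence_space = banach_sequence_space +
  assumes symmetric: "x \<in> E \<Longrightarrow>
    \<exists>y\<in>E. (\<forall>n. ereal (y n) = decreasing_rearrangement x n) \<and> N x = N y"

definition two_concave :: "(nat \<Rightarrow> real) set \<Rightarrow> ((nat \<Rightarrow> real) \<Rightarrow> real) \<Rightarrow> bool" where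
  "two_concave E N \<longleftrightarrow> (\<exists>C>0. \<forall>m. \<forall>x :: nat \<Rightarrow> nat \<Rightarrow> real. (\<forall>i<m. x i \<in> E) \<longrightarrow>
     sqrt (\<Sum>i<m. (N (x i))\<^sup>2) \<le> C * N (\<lambda>n. sqrt (\<Sum>i<m. \<bar>x i n\<bar>\<^sup>2)))"

definition unit_seq :: "nat \<Rightarrow> nat \<Rightarrow> real" where
  "unit_seq i = (\<lambda>j. if j = i then 1 else 0)"

definition fundamental_function :: "((nat \<Rightarrow> real) \<Rightarrow> real) \<Rightarrow> nat \<Rightarrow> real" where
  "fundamental_function N n = N (\<Sum>i<n. unit_seq i)"

text \<open>The common carrier of all spaces \<open>E\<^sub>n\<close>; they differ only in the norm.\<close>

definition unit_span :: "nat \<Rightarrow> (nat \<Rightarrow> real) set" where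
  "unit_span n = span (unit_seq ` {..<n})"

definition l2_norm :: "(nat \<Rightarrow> real) \<Rightarrow> real" where
  "l2_norm x = sqrt (\<Sum>i. \<bar>x i\<bar>\<^sup>2)"

section \<open>Approximation numbers\<close>

text \<open>Operators act between normed spaces given by carriers \<open>X\<close>, \<open>Y\<close> and norms \<open>p\<close>, \<open>q\<close>; their
  values outside \<open>X\<close> are irrelevant.\<close>

definition bounded_operator ::
  "'a::real_vector set \<Rightarrow> ('a \<Rightarrow> real) \<Rightarrow> 'b::real_vector set \<Rightarrow> ('b \<Rightarrow> real) \<Rightarrow> ('a \<Rightarrow> 'b) \<Rightarrow> bool" where
  "bounded_operator X p Y q T \<longleftrightarrow>
     (\<forall>x\<in>X. T x \<in> Y) \<and>
     (\<forall>x\<in>X. \<forall>y\<in>X. T (x + y) = T x + T y) \<and>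
     (\<forall>c. \<forall>x\<in>X. T (c *\<^sub>R x) = c *\<^sub>R T x) \<and>
     (\<exists>K. \<forall>x\<in>X. q (T x) \<le> K * p x)"

definition operator_norm ::
  "'a set \<Rightarrow> ('a \<Rightarrow> real) \<Rightarrow> ('b \<Rightarrow> real) \<Rightarrow> ('a \<Rightarrow> 'b) \<Rightarrow> real" where
  "operator_norm X p q T = (SUP x\<in>{x \<in> X. p x \<le> 1}. q (T x))"

text \<open>The range has a basis with fewer than \<open>k\<close> elements. (The library's \<open>dim\<close> is 0 on
  infinite-dimensional spaces, so \<open>dim (T ` X) < k\<close> alone would not do.)\<close>

definition rank_less :: "'a set \<Rightarrow> ('a \<Rightarrow> 'b::real_vector) \<Rightarrow> nat \<Rightarrow> bool" where
  "rank_less X T k \<longleftrightarrow> (\<exists>B. finite B \<and> independent B \<and> span B = T ` X \<and> card B < k)"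

definition approximation_number ::
  "nat \<Rightarrow> 'a::real_vector set \<Rightarrow> ('a \<Rightarrow> real) \<Rightarrow> 'b::real_vector set \<Rightarrow> ('b \<Rightarrow> real) \<Rightarrow> ('a \<Rightarrow> 'b) \<Rightarrow> real"
where
  "approximation_number k X p Y q T =
     Inf {operator_norm X p q (\<lambda>x. T x - S x) | S. bounded_operator X p Y q S \<and> rank_less X S k}"

end

theory Submission
  imports Defs
begin

text \<open>Put \<open>m = n - k + 1\<close>. Applying 2-concavity to the \<open>m\<close> cyclic shifts of a vector supported on \<open>m\<close>
  coordinates bounds its \<open>E\<close>-norm by \<open>C * \<lambda>(m) / sqrt m\<close> times its \<open>l2\<close>-norm; approximating the
  identity by a coordinate projection of rank \<open>k - 1\<close> gives the upper estimate.

  For the lower estimate, the kernel of an operator of rank less than \<open>k\<close> has dimension at least \<open>m\<close>,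
  so an extreme point \<open>x\<close> of its intersection with the unit cube has at least \<open>m\<close> entries of modulus 1.
  Hence \<open>\<bar>x i\<bar>\<^sup>2 \<le> T\<close> for \<open>T = (l2_norm x)\<^sup>2 / m\<close>, so that \<open>\<bar>x\<bar>\<^sup>2\<close> is a combination, with nonnegative
  coefficients \<open>t\<close> of sum \<open>T\<close>, of indicators of sets \<open>A\<close> with \<open>m\<close> elements. 2-concavity applied to the
  functions \<open>sqrt t\<close> times the indicator of \<open>A\<close> yields \<open>sqrt T * \<lambda>(m) \<le> C * N x\<close>.\<close>

section \<open>Decomposition of bounded vectors into indicators of equal-sized sets\<close>

text \<open>Vectors with entries in \<open>[0, T]\<close> and sum \<open>m * T\<close> form a
  dilated hypersimplex, whose vertices are \<open>T\<close> times the indicators of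
  \<open>m\<close>-element sets. Indicators are peeled off greedily, and what remains is again of
  this form for a smaller \<open>T\<close>.\<close>

lemma hypersimplex_decomposition:
  fixes b :: "'a \<Rightarrow> real"
  assumes "finite I" and "m > 0" and "0 \<le> T"
    and "\<And>i. i \<in> I \<Longrightarrow> 0 \<le> b i" and "\<And>i. i \<in> I \<Longrightarrow> b i \<le> T" and "sum b I = real m * T"
  shows "\<exists>(r::nat) t A. (\<forall>j<r. 0 \<le> t j \<and> A j \<subseteq> I \<and> card (A j) = m)
    \<and> (\<forall>i\<in>I. b i = (\<Sum>j<r. t j * indicator (A j) i)) \<and> (\<Sum>j<r. t j) = T"
  using assms(3-)
\<comment> \<open>The measure counts the entries not yet at 0 and those not yet at the upper bound;
  each peeling step settles at least one more entry.\<close>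
proof (induction "card {i\<in>I. 0 < b i} + card {i\<in>I. b i < T}" arbitrary: b T rule: less_induct)
  case less
  note b = less.prems
  show ?case
  proof (cases "T = 0")
    case True
    then show ?thesis using b by (intro exI[of _ "0::nat"]) force
  next
    case False
    then have T: "T > 0" using b by simp
    define tight where "tight = {i\<in>I. b i = T}"
    define supp where "supp = {i\<in>I. 0 < b i}"
    have sub: "tight \<subseteq> supp" "supp \<subseteq> I" "finite supp"
      using T \<open>finite I\<close> by (auto simp: tight_def supp_def)
    \<comment> \<open>Entries equal to \<open>T\<close> must be lowered and zero entries must not
      be, so \<open>A\<close> has to lie between \<open>tight\<close> and \<open>supp\<close>.
      Comparing both sums with \<open>m * T\<close> shows that a set of size \<open>m\<close>
      fits.\<close>
    have "real (card tight) * T = sum b tight" by (simp add: tight_def)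
    also have "\<dots> \<le> sum b I"
      using b \<open>finite I\<close> by (intro sum_mono2) (auto simp: tight_def)
    finally have 1: "card tight \<le> m" using T b by simp
    have "real m * T = sum b supp"
      using b \<open>finite I\<close> sub by (subst b(4)[symmetric], intro sum.mono_neutral_right) (auto simp: supp_def intro: antisym)
    also have "\<dots> \<le> real (card supp) * T"
      using sum_bounded_above[of supp b T] b sub by auto
    finally have 2: "m \<le> card supp" using T by simp
    \<comment> \<open>Subtract the largest multiple \<open>s\<close> of the indicator of \<open>A\<close> that keeps all entries in \<open>[0, T - s]\<close>;
      then an entry becomes 0 or becomes equal to the new bound.\<close>
    obtain A where A: "tight \<subseteq> A" "A \<subseteq> supp" "card A = m"
      using exists_subset_between[OF 1 2 sub(1) sub(3)] by blast
    have fA: "finite A" "A \<noteq> {}" "A \<subseteq> I" using A sub finite_subset \<open>m > 0\<close> by auto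
    define D where "D = b ` A \<union> (\<lambda>i. T - b i) ` (I - A)"
    define s where "s = Min D"
    have D: "finite D" "D \<noteq> {}" using fA \<open>finite I\<close> by (auto simp: D_def)
    have s_in: "s \<in> D" unfolding s_def using D by simp
    have s_le1: "s \<le> b i" if "i \<in> A" for i using that D by (auto simp: s_def D_def)
    have s_le2: "s \<le> T - b i" if "i \<in> I - A" for i using that D by (auto simp: s_def D_def)
    have sT: "s \<le> T" using s_le1 fA b by fastforce
    have "0 < b i" if "i \<in> A" for i using that A by (auto simp: supp_def)
    moreover have "0 < T - b i" if "i \<in> I - A" for i
      using that A b(3)[of i] by (auto simp: tight_def less_le)
    ultimately have s_pos: "s > 0" using s_in by (auto simp: D_def)
    define b' where "b' i = b i - s * indicator A i" for i
    have b'1: "b' i = b i - s" if "i \<in> A" for i using that by (simp add: b'_def)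
    have b'2: "b' i = b i" if "i \<notin> A" for i using that by (simp add: b'_def)
    have s1: "{i\<in>I. 0 < b' i} \<subseteq> {i\<in>I. 0 < b i}"
      using s_pos by (auto simp: b'_def indicator_def split: if_splits)
    have s2: "{i\<in>I. b' i < T - s} \<subseteq> {i\<in>I. b i < T}"
      using s_pos by (auto simp: b'_def indicator_def split: if_splits)
    have meas: "card {i\<in>I. 0 < b' i} + card {i\<in>I. b' i < T - s}
        < card {i\<in>I. 0 < b i} + card {i\<in>I. b i < T}"
    proof (cases "s \<in> b ` A")
      case True
      then obtain i where "i \<in> A" "s = b i" by blast
      then have "i \<in> {i\<in>I. 0 < b i} - {i\<in>I. 0 < b' i}" using s_pos fA by (auto simp: b'1)
      then have "card {i\<in>I. 0 < b' i} < card {i\<in>I. 0 < b i}"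
        using s1 \<open>finite I\<close> by (intro psubset_card_mono) auto
      moreover have "card {i\<in>I. b' i < T - s} \<le> card {i\<in>I. b i < T}"
        using s2 \<open>finite I\<close> by (intro card_mono) auto
      ultimately show ?thesis by linarith
    next
      case False
      then obtain i where "i \<in> I - A" "s = T - b i" using s_in by (auto simp: D_def)
      then have "i \<in> {i\<in>I. b i < T} - {i\<in>I. b' i < T - s}" using s_pos by (auto simp: b'2)
      then have "card {i\<in>I. b' i < T - s} < card {i\<in>I. b i < T}"
        using s2 \<open>finite I\<close> by (intro psubset_card_mono) auto
      moreover have "card {i\<in>I. 0 < b' i} \<le> card {i\<in>I. 0 < b i}"
        using s1 \<open>finite I\<close> by (intro card_mono) auto
      ultimately show ?thesis by linarith
    qed
    have "sum b' I = real m * (T - s)"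
    proof -
      have "(\<Sum>i\<in>I. s * indicator A i) = s * real (card A)"
        using fA \<open>finite I\<close> by (simp add: sum_distrib_left[symmetric] Int_absorb1 sum.inter_restrict[symmetric] indicator_def)
      then show ?thesis using b A by (simp add: b'_def sum_subtractf algebra_simps)
    qed
    moreover have "0 \<le> b' i" "b' i \<le> T - s" if "i \<in> I" for i
      using that b(2,3)[OF that] s_le1[of i] s_le2[of i]
      by (cases "i \<in> A"; simp add: b'1 b'2)+
    ultimately have "\<exists>(r::nat) t B. (\<forall>j<r. 0 \<le> t j \<and> B j \<subseteq> I \<and> card (B j) = m)
        \<and> (\<forall>i\<in>I. b' i = (\<Sum>j<r. t j * indicator (B j) i)) \<and> (\<Sum>j<r. t j) = T - s"
      using sT by (intro less.hyps[OF meas]) auto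
    then obtain r :: nat and t B where
      r: "\<And>j. j < r \<Longrightarrow> 0 \<le> t j \<and> B j \<subseteq> I \<and> card (B j) = m"
        "\<And>i. i \<in> I \<Longrightarrow> b' i = (\<Sum>j<r. t j * indicator (B j) i)" "(\<Sum>j<r. t j) = T - s"
      by blast
    let ?t = "t(r := s)" and ?B = "B(r := A)"
    have "\<forall>j<Suc r. 0 \<le> ?t j \<and> ?B j \<subseteq> I \<and> card (?B j) = m"
      using r(1) fA A s_pos by (auto simp: less_Suc_eq)
    moreover have "b i = (\<Sum>j<Suc r. ?t j * indicator (?B j) i)" if "i \<in> I" for i
      using r(2)[OF that] by (simp add: b'_def)
    moreover have "(\<Sum>j<Suc r. ?t j) = T" using r(3) by simp
    ultimately show ?thesis by blast
  qed
qed

section \<open>Bijections and the decreasing rearrangement\<close>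

text \<open>\<open>B - A\<close> and \<open>A - B\<close> are equinumerous, so a bijection of
  \<open>A\<close> onto \<open>B\<close> extends by one of \<open>B - A\<close> onto
  \<open>A - B\<close> and by the identity elsewhere.\<close>

lemma exists_bij_image_eq:
  fixes A B :: "'a set"
  assumes "finite A" "finite B" "card A = card B"
  shows "\<exists>p. bij p \<and> p ` A = B"
proof -
  obtain f where f: "bij_betw f A B" using assms finite_same_card_bij by blast
  have "card (B - A) = card (A - B)"
    using assms by (metis card_le_sym_Diff le_antisym order_refl)
  then obtain g where g: "bij_betw g (B - A) (A - B)"
    using finite_same_card_bij[of "B - A" "A - B"] assms by auto
  let ?q = "\<lambda>x. if x \<in> B - A then g x else x"
  let ?p = "\<lambda>x. if x \<in> A then f x else ?q x"
  have q: "bij_betw ?q ((B - A) \<union> - (A \<union> B)) ((A - B) \<union> - (A \<union> B))"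
    by (intro bij_betw_disjoint_Un bij_betw_cong[THEN iffD1, OF _ g] bij_betw_cong[THEN iffD1, OF _ bij_betw_id]) auto
  have "bij_betw ?p (A \<union> ((B - A) \<union> - (A \<union> B))) (B \<union> ((A - B) \<union> - (A \<union> B)))"
    by (intro bij_betw_combine bij_betw_cong[THEN iffD1, OF _ f] bij_betw_cong[THEN iffD1, OF _ q]) auto
  moreover have "A \<union> ((B - A) \<union> - (A \<union> B)) = UNIV" "B \<union> ((A - B) \<union> - (A \<union> B)) = UNIV" by auto
  ultimately have "bij ?p" by simp
  moreover have "?p ` A = B" using bij_betw_imp_surj_on[OF f] by auto
  ultimately show ?thesis by blast
qed

text \<open>Replacing an exceptional set \<open>J\<close> by its preimage under \<open>p\<close>
  increases neither the cardinality nor the supremum, which gives one inequality; the same argument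
  for \<open>inv p\<close> gives the other.\<close>

lemma decreasing_rearrangement_bij:
  assumes "bij p"
  shows "decreasing_rearrangement (x \<circ> p) = decreasing_rearrangement x"
proof -
  have le: "decreasing_rearrangement (x \<circ> p) n \<le> decreasing_rearrangement x n"
    if "bij p" for x and p :: "nat \<Rightarrow> nat" and n
    unfolding decreasing_rearrangement_def
  proof (rule INF_mono)
    fix J :: "nat set" assume J: "J \<in> {J. finite J \<and> card J \<le> n}"
    let ?J = "inv p ` J"
    have ip: "bij (inv p)" using that by (rule bij_imp_bij_inv)
    have "?J \<in> {J. finite J \<and> card J \<le> n}"
      using J card_image_le[of J "inv p"] by auto
    moreover have "(SUP i\<in>UNIV - ?J. ereal \<bar>(x \<circ> p) i\<bar>) \<le> (SUP i\<in>UNIV - J. ereal \<bar>x i\<bar>)"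
    proof (rule SUP_mono)
      fix i assume "i \<in> UNIV - ?J"
      then have "p i \<in> UNIV - J" using that by (metis DiffD2 DiffI UNIV_I bij_inv_eq_iff image_eqI)
      then show "\<exists>j\<in>UNIV - J. ereal \<bar>(x \<circ> p) i\<bar> \<le> ereal \<bar>x j\<bar>" by auto
    qed
    ultimately show "\<exists>J'\<in>{J. finite J \<and> card J \<le> n}.
        (SUP i\<in>UNIV - J'. ereal \<bar>(x \<circ> p) i\<bar>) \<le> (SUP i\<in>UNIV - J. ereal \<bar>x i\<bar>)" by blast
  qed
  have "decreasing_rearrangement ((x \<circ> p) \<circ> inv p) n \<le> decreasing_rearrangement (x \<circ> p) n" for n
    using assms by (intro le bij_imp_bij_inv)
  moreover have "(x \<circ> p) \<circ> inv p = x" using assms by (metis bij_is_surj comp_assoc comp_id surj_iff)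
  ultimately show ?thesis using le[OF assms] by (intro ext antisym) auto
qed

section \<open>Finitely supported sequences and their norms\<close>

lemma sum_fun_apply: "(\<Sum>i\<in>A. f i) x = (\<Sum>i\<in>A. f i x)"
  by (induction A rule: infinite_finite_induct) auto

lemma span_unit_seq:
  assumes "finite A"
  shows "span (unit_seq ` A) = {x. \<forall>i. i \<notin> A \<longrightarrow> x i = 0}"
proof
  have "subspace {x :: nat \<Rightarrow> real. \<forall>i. i \<notin> A \<longrightarrow> x i = 0}"
    by (auto simp: subspace_def scaleR_fun_def)
  then show "span (unit_seq ` A) \<subseteq> {x. \<forall>i. i \<notin> A \<longrightarrow> x i = 0}"
    by (intro span_minimal) (auto simp: unit_seq_def)
  show "{x. \<forall>i. i \<notin> A \<longrightarrow> x i = 0} \<subseteq> span (unit_seq ` A)"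
  proof
    fix x :: "nat \<Rightarrow> real" assume "x \<in> {x. \<forall>i. i \<notin> A \<longrightarrow> x i = 0}"
    then have "x = (\<Sum>i\<in>A. x i *\<^sub>R unit_seq i)"
      using assms by (auto simp: fun_eq_iff sum_fun_apply scaleR_fun_def unit_seq_def if_distrib cong: if_cong)
    also have "\<dots> \<in> span (unit_seq ` A)" by (intro span_sum span_scale span_base) auto
    finally show "x \<in> span (unit_seq ` A)" .
  qed
qed

lemma mem_unit_span: "x \<in> unit_span n \<longleftrightarrow> (\<forall>i\<ge>n. x i = 0)"
  by (auto simp: unit_span_def span_unit_seq)

lemma subspace_unit_span: "subspace (unit_span n)"
  by (simp add: unit_span_def)

lemma l2_norm_unit_span:
  assumes "x \<in> unit_span n"
  shows "l2_norm x = sqrt (\<Sum>i<n. (x i)\<^sup>2)"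
  unfolding l2_norm_def
  using assms by (subst suminf_finite[of "{..<n}"]) (auto simp: mem_unit_span)

lemma l2_norm_ge_0: "x \<in> unit_span n \<Longrightarrow> 0 \<le> l2_norm x"
  by (simp add: l2_norm_unit_span sum_nonneg)

lemma l2_norm_scaleR:
  assumes "x \<in> unit_span n"
  shows "l2_norm (c *\<^sub>R x) = \<bar>c\<bar> * l2_norm x"
  using assms subspace_scale[OF subspace_unit_span assms, of c]
  by (simp add: l2_norm_unit_span scaleR_fun_def power_mult_distrib real_sqrt_mult flip: sum_distrib_left)

lemma fundamental_function_indicator: "fundamental_function N n = N (indicator {..<n})"
  unfolding fundamental_function_def
  by (rule arg_cong[of _ _ N]) (auto simp: fun_eq_iff sum_fun_apply unit_seq_def indicator_def)

lemma bounded_operatorD: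
  assumes "bounded_operator X p Y q T"
  shows "x \<in> X \<Longrightarrow> T x \<in> Y"
    and "x \<in> X \<Longrightarrow> y \<in> X \<Longrightarrow> T (x + y) = T x + T y"
    and "x \<in> X \<Longrightarrow> T (c *\<^sub>R x) = c *\<^sub>R T x"
    and "\<exists>K. \<forall>x\<in>X. q (T x) \<le> K * p x"
  using assms by (simp_all add: bounded_operator_def)

section \<open>Flat vectors in kernels of operators of small rank\<close>

text \<open>This replaces the search for an extreme point of the cube section by a walk: starting
  from 0, move inside \<open>F\<close> along a direction vanishing on the entries already of modulus
  1 until one more entry reaches the boundary of the cube.\<close>

lemma finite_support_extremal:
  fixes F :: "(nat \<Rightarrow> real) set"
  assumes F: "subspace F" "F \<subseteq> unit_span n"
    and ex: "\<And>J. finite J \<Longrightarrow> card J < m \<Longrightarrow> \<exists>y\<in>F. y \<noteq> 0 \<and> (\<forall>i\<in>J. y i = 0)"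
  shows "\<exists>x\<in>F. (\<forall>i. \<bar>x i\<bar> \<le> 1) \<and> (\<exists>J\<subseteq>{..<n}. card J = m \<and> (\<forall>i\<in>J. \<bar>x i\<bar> = 1))"
proof -
  have "\<exists>x\<in>F. (\<forall>i. \<bar>x i\<bar> \<le> 1) \<and> (\<exists>J\<subseteq>{..<n}. card J = k \<and> (\<forall>i\<in>J. \<bar>x i\<bar> = 1))"
    if "k \<le> m" for k
    using that
  proof (induction k)
    case 0
    then show ?case using F by (intro bexI[of _ 0]) (auto simp: subspace_0)
  next
    case (Suc k)
    then obtain x J where x: "x \<in> F" "\<And>i. \<bar>x i\<bar> \<le> 1"
      and J: "J \<subseteq> {..<n}" "card J = k" "\<And>i. i \<in> J \<Longrightarrow> \<bar>x i\<bar> = 1" by auto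
    have fJ: "finite J" using J finite_subset by blast
    obtain y where y: "y \<in> F" "y \<noteq> 0" "\<And>i. i \<in> J \<Longrightarrow> y i = 0"
      using ex[of J] J Suc.prems fJ by auto
    define I where "I = {i. y i \<noteq> 0}"
    have I: "I \<subseteq> {..<n}" using y F by (force simp: I_def mem_unit_span not_less)
    have fI: "finite I" "I \<noteq> {}"
      using I y finite_subset by (auto simp: I_def fun_eq_iff)
    \<comment> \<open>\<open>q i\<close> is the step length at which entry \<open>i\<close> reaches
      \<open>sgn (y i)\<close>, the face it moves towards; the least of these keeps all entries in
      the cube.\<close>
    define q where "q i = (1 - sgn (y i) * x i) / \<bar>y i\<bar>" for i
    define t where "t = Min (q ` I)"
    have "t \<in> q ` I" unfolding t_def using fI by simp
    then obtain l where l: "l \<in> I" "t = q l" by blast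
    have t_le: "t \<le> q i" if "i \<in> I" for i using that fI by (simp add: t_def)
    have sx: "sgn (y i) * x i \<le> 1" for i
      using x(2)[of i] by (auto simp: sgn_real_def)
    have t0: "0 \<le> t" using sx[of l] by (simp add: l q_def)
    let ?x = "x + t *\<^sub>R y"
    have xe: "?x i = x i + t * y i" for i by (simp add: scaleR_fun_def)
    have bd: "\<bar>?x i\<bar> \<le> 1" for i
    proof (cases "i \<in> I")
      case True
      then have "t * \<bar>y i\<bar> \<le> 1 - sgn (y i) * x i"
        using t_le[OF True] by (simp add: q_def I_def field_simps)
      moreover have "0 \<le> t * \<bar>y i\<bar>" using t0 by simp
      ultimately show ?thesis using x(2)[of i] True unfolding xe
        by (auto simp: sgn_real_def I_def abs_if split: if_splits)
    next
      case False
      then show ?thesis using x(2)[of i] unfolding xe by (simp add: I_def)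
    qed
    have "t * \<bar>y l\<bar> = 1 - sgn (y l) * x l" using l by (simp add: q_def I_def)
    then have "\<bar>?x l\<bar> = 1"
      using l unfolding xe by (cases "y l" "0 :: real" rule: linorder_cases) (auto simp: I_def)
    moreover have "\<bar>?x i\<bar> = 1" if "i \<in> J" for i
      unfolding xe using y(3)[OF that] J(3)[OF that] by simp
    \<comment> \<open>Even if \<open>t = 0\<close>, the index \<open>l\<close> is a new one, because
      \<open>y\<close> vanishes on \<open>J\<close> but not at \<open>l\<close>.\<close>
    moreover have "l \<notin> J" using l y by (auto simp: I_def)
    ultimately have "insert l J \<subseteq> {..<n} \<and> card (insert l J) = Suc k \<and> (\<forall>i\<in>insert l J. \<bar>?x i\<bar> = 1)"
      using l I J fJ by auto
    moreover have "?x \<in> F" using x y F by (intro subspace_add subspace_scale)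
    ultimately show ?case using bd by blast
  qed
  then show ?thesis by simp
qed

text \<open>Dimension count: at least \<open>k\<close> unit vectors remain off \<open>J\<close>, and
  their images lie in a space of dimension less than \<open>k\<close>, so some nontrivial
  combination of them is mapped to 0.\<close>

lemma rank_less_kernel:
  assumes S: "\<And>x y. x \<in> unit_span n \<Longrightarrow> y \<in> unit_span n \<Longrightarrow> S (x + y) = S x + S y"
      "\<And>c x. x \<in> unit_span n \<Longrightarrow> S (c *\<^sub>R x) = c *\<^sub>R S x"
    and rank: "rank_less (unit_span n) S k"
    and J: "finite J" "card J + k \<le> n"
  shows "\<exists>y\<in>unit_span n. S y = 0 \<and> y \<noteq> 0 \<and> (\<forall>i\<in>J. y i = 0)"
proof -
  define I where "I = {..<n} - J"
  have fI: "finite I" by (simp add: I_def)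
  have I: "i < n" "i \<notin> J" if "i \<in> I" for i using that by (auto simp: I_def)
  have cI: "k \<le> card I"
    using diff_card_le_card_Diff[of J "{..<n}"] J by (simp add: I_def)
  have e: "unit_seq i \<in> unit_span n" if "i \<in> I" for i
    using I[OF that] by (auto simp: mem_unit_span unit_seq_def)
  \<comment> \<open>Linearity of \<open>S\<close> is available only on \<open>unit_span n\<close>,
    so membership of the partial sums is carried through the induction.\<close>
  have S_sum: "S (\<Sum>i\<in>A. c i *\<^sub>R unit_seq i) = (\<Sum>i\<in>A. c i *\<^sub>R S (unit_seq i))
      \<and> (\<Sum>i\<in>A. c i *\<^sub>R unit_seq i) \<in> unit_span n" if "finite A" "A \<subseteq> I" for A c
    using that
  proof induction
    case empty
    have "S 0 = 0" using S(2)[of 0 0] subspace_0[OF subspace_unit_span] by simp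
    then show ?case using subspace_0[OF subspace_unit_span] by (simp add: zero_fun_def)
  next
    case (insert i A)
    let ?a = "c i *\<^sub>R unit_seq i" and ?b = "\<Sum>i\<in>A. c i *\<^sub>R unit_seq i"
    have a: "unit_seq i \<in> unit_span n" "?a \<in> unit_span n" and b: "?b \<in> unit_span n"
      using insert e subspace_scale[OF subspace_unit_span] by blast+
    have "S (?a + ?b) = c i *\<^sub>R S (unit_seq i) + S ?b"
      by (simp only: S(1)[OF a(2) b] S(2)[OF a(1)])
    then show ?case
      unfolding sum.insert[OF insert.hyps]
      using insert subspace_add[OF subspace_unit_span a(2) b] by (simp only: insert_subset)
  qed
  have "\<exists>c. (\<exists>i\<in>I. c i \<noteq> 0) \<and> (\<Sum>i\<in>I. c i *\<^sub>R S (unit_seq i)) = 0"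
  \<comment> \<open>Dependence is a property of the set of images and does not see repetitions; two
    equal images give a relation with coefficients 1 and -1 directly.\<close>
  proof (cases "inj_on (\<lambda>i. S (unit_seq i)) I")
    case True
    let ?V = "(\<lambda>i. S (unit_seq i)) ` I"
    obtain B where B: "finite B" "span B = S ` unit_span n" "card B < k"
      using rank by (auto simp: rank_less_def)
    have "\<not> independent ?V"
    proof
      assume "independent ?V"
      moreover have "?V \<subseteq> span B" using e B by auto
      ultimately have "card ?V \<le> card B" using independent_span_bound B by blast
      then show False using B cI card_image[OF True] by simp
    qed
    then obtain u where u: "\<exists>v\<in>?V. u v \<noteq> 0" "(\<Sum>v\<in>?V. u v *\<^sub>R v) = 0"
      using dependent_finite[of ?V] fI by auto
    then show ?thesis
      by (intro exI[of _ "\<lambda>i. u (S (unit_seq i))"]) (auto simp: sum.reindex[OF True] o_def)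
  next
    case False
    then obtain a b where ab: "a \<in> I" "b \<in> I" "a \<noteq> b" "S (unit_seq a) = S (unit_seq b)"
      by (auto simp: inj_on_def)
    let ?c = "\<lambda>i. if i = a then 1 else if i = b then -1 else 0 :: real"
    have "(\<Sum>i\<in>I. ?c i *\<^sub>R S (unit_seq i)) = (\<Sum>i\<in>{a, b}. ?c i *\<^sub>R S (unit_seq i))"
      using ab fI by (intro sum.mono_neutral_right) auto
    also have "\<dots> = 0" using ab by simp
    finally show ?thesis using ab by (intro exI[of _ ?c]) auto
  qed
  then obtain c i where c: "i \<in> I" "c i \<noteq> 0" "(\<Sum>i\<in>I. c i *\<^sub>R S (unit_seq i)) = 0" by blast
  let ?y = "\<Sum>i\<in>I. c i *\<^sub>R unit_seq i"
  have ye: "?y j = (if j \<in> I then c j else 0)" for j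
    using fI by (simp add: sum_fun_apply scaleR_fun_def unit_seq_def if_distrib cong: if_cong)
  have "?y i \<noteq> 0" using c by (simp add: ye)
  then have "?y \<noteq> 0" by (metis zero_fun_apply)
  moreover have "?y j = 0" if "j \<in> J" for j using that by (subst ye) (simp add: I_def)
  ultimately show ?thesis using S_sum[OF fI order_refl, of c] c by auto
qed

text \<open>A maximal independent subset of the spanning unit vectors serves as the basis, so only
  the bound on its cardinality has to be checked.\<close>

lemma rank_less_unit_seqI:
  fixes S :: "'a \<Rightarrow> nat \<Rightarrow> real"
  assumes "finite A" "card A < k" "S ` X = {x. \<forall>i. i \<notin> A \<longrightarrow> x i = 0}"
  shows "rank_less X S k"
proof -
  obtain B where B: "B \<subseteq> unit_seq ` A" "independent B" "unit_seq ` A \<subseteq> span B"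
    using maximal_independent_subset by blast
  have fin: "finite B" using B(1) assms(1) finite_subset by blast
  have "card B \<le> card A"
    using B(1) assms(1) by (metis card_image_le card_mono finite_imageI order_trans)
  moreover have "span B = S ` X"
    unfolding assms(3) span_unit_seq[OF assms(1), symmetric]
    using B(1,3) by (metis span_mono span_span subset_antisym)
  ultimately show ?thesis
    unfolding rank_less_def using B(2) fin assms(2) by (meson le_less_trans)
qed

section \<open>Unit vectors, indicators and invariance under permutations\<close>

context banach_sequence_space
begin

text \<open>A vector of \<open>E\<close> without zero entries, rescaled to be 1 at coordinate
  \<open>i\<close>, dominates \<open>unit_seq i\<close>; the ideal property then applies.\<close>

lemma unit_span_subset: "unit_span n \<subseteq> E"
proof -
  obtain x where x: "x \<in> E" "\<And>n. x n \<noteq> 0" using full_support by blast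
  have "unit_seq i \<in> E" for i
  proof -
    have "(1 / x i) *\<^sub>R x \<in> E" using x subspace_scale[OF subspace_E] by blast
    then show ?thesis
      by (rule ideal[THEN conjunct1]) (auto simp: unit_seq_def scaleR_fun_def x)
  qed
  then show ?thesis unfolding unit_span_def by (intro span_minimal subspace_E) auto
qed

lemma indicator_mem: "finite A \<Longrightarrow> indicator A \<in> E"
proof -
  assume "finite A"
  then obtain n where "A \<subseteq> {..<n}" using finite_nat_bounded by blast
  then have "indicator A \<in> unit_span n" by (force simp: mem_unit_span indicator_def)
  then show ?thesis using unit_span_subset by blast
qed

end

context symmetric_banach_sequence_space
begin

lemma norm_bij:
  assumes "x \<in> E" "x \<circ> p \<in> E" "bij p"
  shows "N (x \<circ> p) = N x"
proof -
  obtain y where "\<forall>n. ereal (y n) = decreasing_rearrangement x n" "N x = N y"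
    using symmetric[OF assms(1)] by blast
  moreover obtain z where "\<forall>n. ereal (z n) = decreasing_rearrangement (x \<circ> p) n" "N (x \<circ> p) = N z"
    using symmetric[OF assms(2)] by blast
  ultimately have "y = z" "N (x \<circ> p) = N z" "N x = N y"
    using decreasing_rearrangement_bij[OF assms(3)] by (auto simp: fun_eq_iff) (metis ereal.inject)
  then show ?thesis by simp
qed

lemma norm_indicator:
  assumes "finite A"
  shows "N (indicator A) = fundamental_function N (card A)"
proof -
  obtain p where p: "bij p" "p ` A = {..<card A}"
    using exists_bij_image_eq[of A "{..<card A}"] assms by auto
  have "indicator {..<card A} \<circ> p = (indicator A :: nat \<Rightarrow> real)"
  proof
    fix i
    have "p i \<in> {..<card A} \<longleftrightarrow> i \<in> A"
      using inj_image_mem_iff[OF bij_is_inj[OF p(1)]] p(2) by metis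
    then show "(indicator {..<card A} \<circ> p) i = (indicator A i :: real)"
      by (simp add: indicator_def)
  qed
  then show ?thesis
    unfolding fundamental_function_indicator
    using norm_bij[of "indicator {..<card A}" p] indicator_mem assms p by simp
qed

end

section \<open>Consequences of 2-concavity\<close>

text \<open>Fixing a witness \<open>C\<close> of 2-concavity makes the constants explicit:
  \<open>C\<close> in the upper estimate and \<open>1 / C\<close> in the lower one.\<close>

locale two_concave_sequence_space = symmetric_banach_sequence_space +
  fixes C :: real
  assumes C_pos: "C > 0"
    and two_concave_le: "(\<And>i. i < m \<Longrightarrow> x i \<in> E) \<Longrightarrow>
      sqrt (\<Sum>i<m. (N (x i))\<^sup>2) \<le> C * N (\<lambda>n. sqrt (\<Sum>i<(m::nat). \<bar>x i n\<bar>\<^sup>2))"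
begin

text \<open>At each coordinate below \<open>m\<close> the cyclic shifts run through every entry
  once, so their square function is the constant \<open>l2_norm x\<close> on \<open>{..<m}\<close>,
  while each shift has norm \<open>N x\<close>.\<close>

lemma norm_upper_bound:
  assumes x: "x \<in> unit_span m" and m: "m > 0"
  shows "N x \<le> C * (fundamental_function N m / sqrt m) * l2_norm x"
proof -
  define p where "p j i = (if i < m then (i + j) mod m else i)" for i j :: nat
  have perm: "p j permutes {..<m}" for j
  proof (rule bij_imp_permutes)
    have "inj_on (p j) {..<m}"
    proof (rule inj_onI)
      \<comment> \<open>In the integers the shift \<open>j\<close> can be subtracted again modulo
        \<open>m\<close>.\<close>
      fix a b assume ab: "a \<in> {..<m}" "b \<in> {..<m}" "p j a = p j b"
      then have "(int a + int j) mod int m = (int b + int j) mod int m"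
        by (simp add: p_def flip: zmod_int of_nat_add)
      then have "(int a + int j - int j) mod int m = (int b + int j - int j) mod int m"
        by (rule mod_diff_cong) simp
      then show "a = b" using ab by simp
    qed
    moreover have "p j ` {..<m} \<subseteq> {..<m}" using m by (auto simp: p_def)
    ultimately show "bij_betw (p j) {..<m} {..<m}"
      by (simp add: bij_betw_def endo_inj_surj)
  qed (simp add: p_def)
  have xp: "x \<circ> p j \<in> unit_span m" for j
    using x by (auto simp: mem_unit_span p_def)
  have Np: "N (x \<circ> p j) = N x" for j
    using norm_bij[OF _ _ permutes_bij[OF perm]] x xp unit_span_subset by blast
  have "(\<Sum>j<m. \<bar>(x \<circ> p j) i\<bar>\<^sup>2) = (l2_norm x)\<^sup>2 * indicator {..<m} i" for i
  proof (cases "i < m")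
    case True
    \<comment> \<open>By the symmetry of \<open>i + j\<close>, the shift index at a fixed coordinate
      is itself permuted by \<open>p i\<close>.\<close>
    have "(\<Sum>j<m. (x ((i + j) mod m))\<^sup>2) = (\<Sum>j<m. (x (p i j))\<^sup>2)"
      by (intro sum.cong) (auto simp: p_def add.commute)
    also have "\<dots> = (\<Sum>j<m. (x j)\<^sup>2)"
      using sum.permute[OF perm, of "\<lambda>j. (x j)\<^sup>2" i] by (simp add: o_def)
    finally show ?thesis using True x by (simp add: p_def l2_norm_unit_span sum_nonneg)
  next
    case False
    then show ?thesis using x by (simp add: p_def mem_unit_span)
  qed
  then have "(\<lambda>i. sqrt (\<Sum>j<m. \<bar>(x \<circ> p j) i\<bar>\<^sup>2)) = (l2_norm x) *\<^sub>R indicator {..<m}"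
    by (auto simp: fun_eq_iff scaleR_fun_def real_sqrt_mult indicator_def l2_norm_unit_span[OF x] sum_nonneg)
  then have "sqrt (\<Sum>j<m. (N (x \<circ> p j))\<^sup>2) \<le> C * (\<bar>l2_norm x\<bar> * fundamental_function N m)"
    using two_concave_le[of m "\<lambda>j. x \<circ> p j"] xp unit_span_subset indicator_mem
    by (auto simp: norm_scaleR fundamental_function_indicator)
  moreover have "sqrt (\<Sum>j<m. (N (x \<circ> p j))\<^sup>2) = sqrt m * N x"
    using norm_ge_0[of x] x unit_span_subset[of m] by (auto simp: Np real_sqrt_mult)
  moreover have "0 \<le> l2_norm x" by (simp add: l2_norm_unit_span[OF x] sum_nonneg)
  ultimately show ?thesis using m by (simp add: field_simps)
qed

text \<open>The assumption \<open>flat\<close> is the upper bound on entries that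
  \<open>hypersimplex_decomposition\<close> asks for, applied to the squares of
  \<open>x\<close>.\<close>

lemma norm_lower_bound:
  assumes x: "x \<in> unit_span n" and m: "m > 0"
    and flat: "\<And>i. (x i)\<^sup>2 \<le> (l2_norm x)\<^sup>2 / m"
  shows "fundamental_function N m / sqrt m * l2_norm x \<le> C * N x"
proof -
  let ?T = "(l2_norm x)\<^sup>2 / m" and ?l = "fundamental_function N m"
  have l2: "(l2_norm x)\<^sup>2 = (\<Sum>i<n. (x i)\<^sup>2)" "0 \<le> l2_norm x"
    by (simp_all add: l2_norm_unit_span[OF x] sum_nonneg)
  have "\<exists>(r::nat) t A. (\<forall>j<r. 0 \<le> t j \<and> A j \<subseteq> {..<n} \<and> card (A j) = m)
      \<and> (\<forall>i\<in>{..<n}. (x i)\<^sup>2 = (\<Sum>j<r. t j * indicator (A j) i)) \<and> (\<Sum>j<r. t j) = ?T"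
    by (rule hypersimplex_decomposition) (use m flat l2 in \<open>auto simp: sum_nonneg\<close>)
  then obtain r :: nat and t A where "\<forall>j<r. 0 \<le> t j \<and> A j \<subseteq> {..<n} \<and> card (A j) = m"
      "\<forall>i\<in>{..<n}. (x i)\<^sup>2 = (\<Sum>j<r. t j * indicator (A j) i)" "(\<Sum>j<r. t j) = ?T"
    by blast
  then have r: "\<And>j. j < r \<Longrightarrow> 0 \<le> t j \<and> A j \<subseteq> {..<n} \<and> card (A j) = m"
      "\<And>i. i < n \<Longrightarrow> (x i)\<^sup>2 = (\<Sum>j<r. t j * indicator (A j) i)" "(\<Sum>j<r. t j) = ?T"
    by auto
  have fA: "finite (A j)" if "j < r" for j using r(1)[OF that] finite_subset by blast
  have l0: "0 \<le> ?l" using norm_ge_0 indicator_mem by (simp add: fundamental_function_indicator)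
  have xE: "x \<in> E" using x unit_span_subset by blast
  \<comment> \<open>With the weight \<open>sqrt (t j)\<close> the square function of the
    \<open>z j\<close> is the modulus of \<open>x\<close>, and their squared norms add up to
    \<open>?T * ?l\<^sup>2\<close>.\<close>
  define z where "z j = sqrt (t j) *\<^sub>R (indicator (A j) :: nat \<Rightarrow> real)" for j
  have zE: "z j \<in> E" if "j < r" for j
    unfolding z_def using indicator_mem fA that subspace_scale[OF subspace_E] by blast
  have Nz: "(N (z j))\<^sup>2 = t j * ?l\<^sup>2" if "j < r" for j
    using r(1)[OF that] indicator_mem fA[OF that]
    by (simp add: z_def norm_scaleR norm_indicator power_mult_distrib)
  have "(\<Sum>j<r. \<bar>z j i\<bar>\<^sup>2) = (x i)\<^sup>2" for i
  proof -
    have "(\<Sum>j<r. \<bar>z j i\<bar>\<^sup>2) = (\<Sum>j<r. t j * indicator (A j) i)"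
      using r(1) by (intro sum.cong) (auto simp: z_def scaleR_fun_def indicator_def)
    also have "\<dots> = (x i)\<^sup>2"
    proof (cases "i < n")
      case False
      then have "(\<Sum>j<r. t j * indicator (A j) i) = 0"
        using r(1) by (intro sum.neutral) (auto simp: indicator_def)
      then show ?thesis using False x by (simp add: mem_unit_span)
    qed (simp add: r)
    finally show ?thesis .
  qed
  then have "sqrt (\<Sum>j<r. (N (z j))\<^sup>2) \<le> C * N (\<lambda>i. \<bar>x i\<bar>)"
    using two_concave_le[of r z] zE by simp
  also have "\<dots> \<le> C * N x" using ideal[OF xE, of "\<lambda>i. \<bar>x i\<bar>"] C_pos by simp
  finally have "sqrt (\<Sum>j<r. (N (z j))\<^sup>2) \<le> C * N x" .
  moreover have "(\<Sum>j<r. (N (z j))\<^sup>2) = ?T * ?l\<^sup>2"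
    by (simp add: Nz r(3)[symmetric] sum_distrib_right)
  moreover have "sqrt (?T * ?l\<^sup>2) = ?l / sqrt m * l2_norm x"
    using l0 l2(2) by (simp add: real_sqrt_mult real_sqrt_divide)
  ultimately show ?thesis by simp
qed

section \<open>Estimates for the approximation numbers\<close>

text \<open>\<open>operator_norm\<close> is a supremum of reals; boundedness is needed before a
  single test vector can bound it from below.\<close>

lemma bdd_above_error:
  assumes S: "bounded_operator (unit_span n) l2_norm (unit_span n) N S" and n: "n > 0"
  shows "bdd_above ((\<lambda>x. N (x - S x)) ` {x \<in> unit_span n. l2_norm x \<le> 1})"
proof -
  have "\<exists>K. \<forall>x\<in>unit_span n. N (S x) \<le> K * l2_norm x"
    by (rule bounded_operatorD(4)[OF S])
  then obtain K where K: "\<And>x. x \<in> unit_span n \<Longrightarrow> N (S x) \<le> K * l2_norm x" by blast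
  note S_mem = bounded_operatorD(1)[OF S]
  let ?L = "C * (fundamental_function N n / sqrt n)"
  have "N (x - S x) \<le> \<bar>?L\<bar> + \<bar>K\<bar>" if x: "x \<in> unit_span n" "l2_norm x \<le> 1" for x
  proof -
    have E: "x \<in> E" "S x \<in> E" "(- 1) *\<^sub>R S x \<in> E"
      using x S_mem unit_span_subset subspace_scale[OF subspace_E] by blast+
    have bound: "c * l2_norm x \<le> \<bar>c\<bar>" for c
      using x(2) l2_norm_ge_0[OF x(1)] mult_mono[of c "\<bar>c\<bar>" "l2_norm x" 1] by simp
    have "N (x - S x) = N (x + (- 1) *\<^sub>R S x)" by simp
    also have "\<dots> \<le> N x + N ((- 1) *\<^sub>R S x)" using E by (intro norm_triangle)
    also have "N ((- 1) *\<^sub>R S x) = N (S x)" using norm_scaleR[OF E(2), of "- 1"] by simp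
    also have "N x \<le> \<bar>?L\<bar>" using norm_upper_bound[OF x(1) n] bound[of ?L] by linarith
    also have "N (S x) \<le> \<bar>K\<bar>" using K[OF x(1)] bound[of K] by linarith
    finally show ?thesis by (simp only: add_left_mono add_right_mono)
  qed
  then show ?thesis by (intro bdd_aboveI2) auto
qed

text \<open>On the kernel of \<open>S\<close> the error \<open>x - S x\<close> is \<open>x\<close>
  itself, so a normalised flat kernel vector tests the operator norm.\<close>

lemma operator_norm_error_lower_bound:
  assumes S: "bounded_operator (unit_span n) l2_norm (unit_span n) N S"
    and rank: "rank_less (unit_span n) S k" and k: "1 \<le> k" "k \<le> n"
  shows "fundamental_function N (n - k + 1) / sqrt (real (n - k + 1)) / C
    \<le> operator_norm (unit_span n) l2_norm N (\<lambda>x. x - S x)"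
proof -
  define m where "m = n - k + 1"
  have m: "m > 0" "m + k = n + 1" using k by (auto simp: m_def)
  note sub = subspace_0[OF subspace_unit_span] subspace_add[OF subspace_unit_span]
    subspace_scale[OF subspace_unit_span]
  note add = bounded_operatorD(2)[OF S] and scale = bounded_operatorD(3)[OF S]
  let ?F = "{x \<in> unit_span n. S x = 0}"
  have S0: "S 0 = 0" using scale[of 0 0] sub(1) by simp
  have F: "subspace ?F"
  proof (rule subspaceI)
    show "0 \<in> ?F" using sub(1) S0 by simp
    show "x + y \<in> ?F" if "x \<in> ?F" "y \<in> ?F" for x y
      using that sub(2)[of x n y] add[of x y] by (simp del: plus_fun_apply)
    show "c *\<^sub>R x \<in> ?F" if "x \<in> ?F" for c x
      using that sub(3)[of x n c] scale[of x c] by simp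
  qed
  have ex: "\<exists>y\<in>?F. y \<noteq> 0 \<and> (\<forall>i\<in>J. y i = 0)" if "finite J" "card J < m" for J
  proof -
    have "card J + k \<le> n" using that m by linarith
    then show ?thesis using rank_less_kernel[OF add scale rank that(1)] by blast
  qed
  obtain x J where x: "x \<in> unit_span n" "S x = 0" "\<And>i. \<bar>x i\<bar> \<le> 1"
    and J: "J \<subseteq> {..<n}" "card J = m" "\<And>i. i \<in> J \<Longrightarrow> \<bar>x i\<bar> = 1"
    using finite_support_extremal[OF F _ ex] by blast
  let ?s = "l2_norm x"
  \<comment> \<open>The \<open>m\<close> unimodular entries give \<open>m \<le> ?s\<^sup>2\<close>;
    with all entries bounded by 1 this is the flatness required by
    \<open>norm_lower_bound\<close>.\<close>
  have "(x i)\<^sup>2 = 1" if "i \<in> J" for i using J(3)[OF that] by (metis power2_abs one_power2)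
  then have "real m = (\<Sum>i\<in>J. (x i)\<^sup>2)" using J(2) by simp
  also have "\<dots> \<le> (\<Sum>i<n. (x i)\<^sup>2)" using J(1) by (intro sum_mono2) auto
  also have "\<dots> = ?s\<^sup>2" by (simp add: l2_norm_unit_span[OF x(1)] sum_nonneg)
  finally have ms: "real m \<le> ?s\<^sup>2" .
  have s: "?s > 0" using ms m l2_norm_ge_0[OF x(1)] by (cases "?s = 0") auto
  have "(x i)\<^sup>2 \<le> ?s\<^sup>2 / m" for i
  proof -
    have "(x i)\<^sup>2 \<le> 1" using x(3)[of i] by (simp add: abs_square_le_1)
    also have "1 \<le> ?s\<^sup>2 / m" using ms m by simp
    finally show ?thesis .
  qed
  then have "fundamental_function N m / sqrt m * ?s \<le> C * N x"
    by (rule norm_lower_bound[OF x(1) m(1)])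
  then have "fundamental_function N m / sqrt m / C \<le> N x / ?s"
    unfolding pos_divide_le_eq[OF C_pos] times_divide_eq_left pos_le_divide_eq[OF s]
    by (simp only: mult.commute)
  also have "\<dots> = N ((1 / ?s) *\<^sub>R x)"
    using norm_scaleR[of x "1 / ?s"] x(1) unit_span_subset[of n] s by auto
  also have "\<dots> = N ((1 / ?s) *\<^sub>R x - S ((1 / ?s) *\<^sub>R x))"
    by (simp add: scale[OF x(1)] x(2))
  also have "\<dots> \<le> operator_norm (unit_span n) l2_norm N (\<lambda>x. x - S x)"
    unfolding operator_norm_def
  proof (rule cSUP_upper)
    show "(1 / ?s) *\<^sub>R x \<in> {x \<in> unit_span n. l2_norm x \<le> 1}"
      using sub(3)[OF x(1)] l2_norm_scaleR[OF x(1), of "1 / ?s"] s by simp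
    show "bdd_above ((\<lambda>x. N (x - S x)) ` {x \<in> unit_span n. l2_norm x \<le> 1})"
      using bdd_above_error[OF S] k by simp
  qed
  finally show ?thesis by (simp add: m_def)
qed

lemma operator_norm_error_upper_bound:
  assumes k: "1 \<le> k" "k \<le> n"
  shows "\<exists>S. bounded_operator (unit_span n) l2_norm (unit_span n) N S \<and> rank_less (unit_span n) S k
    \<and> operator_norm (unit_span n) l2_norm N (\<lambda>x. x - S x)
      \<le> C * (fundamental_function N (n - k + 1) / sqrt (real (n - k + 1)))"
proof -
  define m where "m = n - k + 1"
  have m: "m > 0" "m \<le> n" "m + k = n + 1" "n > 0" using k by (auto simp: m_def)
  let ?R = "fundamental_function N m / sqrt m"
  have R0: "0 \<le> ?R"
    using norm_ge_0[OF indicator_mem[of "{..<m}"]] by (simp add: fundamental_function_indicator)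
  \<comment> \<open>\<open>P\<close> keeps the last \<open>n - m = k - 1\<close> coordinates, so its
    rank is below \<open>k\<close> and the error lives on the first \<open>m\<close>.\<close>
  define P :: "(nat \<Rightarrow> real) \<Rightarrow> nat \<Rightarrow> real" where "P x = (\<lambda>i. if i < m then 0 else x i)" for x
  have P_mem: "P x \<in> unit_span n" "x - P x \<in> unit_span m" if "x \<in> unit_span n" for x
    using that by (auto simp: mem_unit_span P_def)
  \<comment> \<open>For boundedness of \<open>P\<close> any constant will do, so the estimate on all
    \<open>n\<close> coordinates suffices.\<close>
  have "N (P x) \<le> C * (fundamental_function N n / sqrt n) * l2_norm x" if "x \<in> unit_span n" for x
  proof -
    have "N (P x) \<le> N x"
      using that unit_span_subset by (intro ideal[THEN conjunct2]) (auto simp: P_def)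
    also have "\<dots> \<le> C * (fundamental_function N n / sqrt n) * l2_norm x"
      using that m(4) by (rule norm_upper_bound)
    finally show ?thesis .
  qed
  moreover have "P (x + y) = P x + P y" "P (c *\<^sub>R x) = c *\<^sub>R P x" for x y c
    by (simp_all add: P_def fun_eq_iff scaleR_fun_def)
  ultimately have bdd: "bounded_operator (unit_span n) l2_norm (unit_span n) N P"
    using P_mem unfolding bounded_operator_def by blast
  have "P ` unit_span n = {x. \<forall>i. i \<notin> {m..<n} \<longrightarrow> x i = 0}"
  proof -
    have "x \<in> P ` unit_span n" if "\<forall>i. i \<notin> {m..<n} \<longrightarrow> x i = 0" for x
      using that by (intro image_eqI[of _ P x]) (auto simp: P_def mem_unit_span fun_eq_iff)
    then show ?thesis by (auto simp: P_def mem_unit_span)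
  qed
  then have rank: "rank_less (unit_span n) P k"
    using m by (intro rank_less_unit_seqI[of "{m..<n}"]) auto
  have "operator_norm (unit_span n) l2_norm N (\<lambda>x. x - P x) \<le> C * ?R"
    unfolding operator_norm_def
  proof (rule cSUP_least)
    show "{x \<in> unit_span n. l2_norm x \<le> 1} \<noteq> {}"
      using subspace_0[OF subspace_unit_span, of n] l2_norm_unit_span[of 0 n] by auto
    fix x assume "x \<in> {x \<in> unit_span n. l2_norm x \<le> 1}"
    then have x: "x \<in> unit_span n" "l2_norm x \<le> 1" by auto
    have "(\<Sum>i<m. ((x - P x) i)\<^sup>2) = (\<Sum>i<m. (x i)\<^sup>2)" by (simp add: P_def)
    also have "\<dots> \<le> (\<Sum>i<n. (x i)\<^sup>2)" using m by (intro sum_mono2) auto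
    finally have "l2_norm (x - P x) \<le> l2_norm x"
      unfolding l2_norm_unit_span[OF x(1)] l2_norm_unit_span[OF P_mem(2)[OF x(1)]]
      by (rule real_sqrt_le_mono)
    then have l2: "l2_norm (x - P x) \<le> 1" using x by simp
    have "N (x - P x) \<le> C * ?R * l2_norm (x - P x)"
      using P_mem(2)[OF x(1)] m(1) by (rule norm_upper_bound)
    also have "\<dots> \<le> C * ?R * 1"
      using l2 mult_nonneg_nonneg[OF less_imp_le[OF C_pos] R0] by (rule mult_left_mono)
    finally show "N (x - P x) \<le> C * ?R" by simp
  qed
  with bdd rank show ?thesis unfolding m_def by blast
qed

end

theorem theorem5p1:
  fixes E :: "(nat \<Rightarrow> real) set" and N :: "(nat \<Rightarrow> real) \<Rightarrow> real"
  assumes "symmetric_banach_sequence_space E N" and "two_concave E N"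
  shows "\<exists>c>0. \<exists>C>0. \<forall>n k. 1 \<le> k \<and> k \<le> n \<longrightarrow>
    c * (fundamental_function N (n - k + 1) / sqrt (real (n - k + 1)))
      \<le> approximation_number k (unit_span n) l2_norm (unit_span n) N (\<lambda>x. x) \<and>
    approximation_number k (unit_span n) l2_norm (unit_span n) N (\<lambda>x. x)
      \<le> C * (fundamental_function N (n - k + 1) / sqrt (real (n - k + 1)))"
proof -
  interpret symmetric_banach_sequence_space E N by fact
  obtain C where C: "C > 0" "\<forall>m. \<forall>x :: nat \<Rightarrow> nat \<Rightarrow> real. (\<forall>i<m. x i \<in> E) \<longrightarrow>
      sqrt (\<Sum>i<m. (N (x i))\<^sup>2) \<le> C * N (\<lambda>n. sqrt (\<Sum>i<m. \<bar>x i n\<bar>\<^sup>2))"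
    using assms(2) unfolding two_concave_def by blast
  interpret two_concave_sequence_space E N C
    by unfold_locales (use C in simp_all)
  have "1 / C * (fundamental_function N (n - k + 1) / sqrt (real (n - k + 1)))
      \<le> approximation_number k (unit_span n) l2_norm (unit_span n) N (\<lambda>x. x) \<and>
    approximation_number k (unit_span n) l2_norm (unit_span n) N (\<lambda>x. x)
      \<le> C * (fundamental_function N (n - k + 1) / sqrt (real (n - k + 1)))"
    if k: "1 \<le> k" "k \<le> n" for n k
  proof -
    let ?R = "fundamental_function N (n - k + 1) / sqrt (real (n - k + 1))"
    let ?D = "{operator_norm (unit_span n) l2_norm N (\<lambda>x. x - S x) | S.
      bounded_operator (unit_span n) l2_norm (unit_span n) N S \<and> rank_less (unit_span n) S k}"
    \<comment> \<open>The real infimum needs a nonempty set bounded below: \<open>d\<close> is a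
      member, which also yields the upper estimate, and \<open>ge\<close> provides the lower
      bound.\<close>
    obtain d where d: "d \<in> ?D" "d \<le> C * ?R"
      using operator_norm_error_upper_bound[OF k] by blast
    have ge: "?R / C \<le> e" if "e \<in> ?D" for e
      using that operator_norm_error_lower_bound[OF _ _ k] by blast
    have "?R / C \<le> Inf ?D" using d(1) ge by (intro cInf_greatest) blast+
    moreover have "Inf ?D \<le> d" using d(1) ge by (intro cInf_lower bdd_belowI[of _ "?R / C"])
    ultimately show ?thesis using d(2) unfolding approximation_number_def by (simp add: mult.commute)
  qed
  moreover have "0 < 1 / C" using C by simp
  ultimately show ?thesis using C(1) by blast
qed

end
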